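(* Let $n\ge3$ and let $P$ be the $n$-dimensional cross polytope, the convex hull in $\mathbb{R}^n$ of all vectors obtained by permuting the coordinates of $(\pm1,0,\ldots,0)$. Then its face lattice $L(P)$ is not isomorphic to the core of any upho lattice.
   Context: The face lattice of a polytope is the poset of its faces (including the empty face and the polytope itself) ordered by inclusion; it is a finite graded lattice with rank of a face $F$ equal to $\dim F+1$. A poset $\mathcal{P}$ is finite type $\mathbb{N}$-graded if it has a minimum $\hat0$, a rank function $\rho$ with $\rho(\hat0)=0$ such that every maximal chain has the form $\hat0=x_0\lessdot x_1\lessdot\cdots$ with $\rho(x_i)=i$, and finitely many elements of each rank. An upho lattice is a finite type $\mathbb{N}$-graded lattice $\mathcal{L}$ with at least two elements such that for every $p\in\mathcal{L}$ the principal filter $\{q\ge p\}$ is isomorphic to $\mathcal{L}$. Its core is the interval $[\hat0,s_1\vee\cdots\vee s_r]$ with $s_1,\ldots,s_r$ the atoms of $\mathcal{L}$. *)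

theory Defs
  imports "HOL-Algebra.Lattice" "HOL-Analysis.Analysis"
begin

section \<open>Posets\<close>

text \<open>
  Posets are the order records of \<^theory>\<open>HOL-Algebra.Order\<close>; a subset \<open>A\<close> of a poset \<open>L\<close>
  carries the induced order \<open>L\<lparr>carrier := A\<rparr>\<close>.
\<close>

definition order_isomorphic :: "('a, 'c) gorder_scheme \<Rightarrow> ('b, 'd) gorder_scheme \<Rightarrow> bool" where
  "order_isomorphic L M \<longleftrightarrow>
     (\<exists>f. bij_betw f (carrier L) (carrier M) \<and>
          (\<forall>x\<in>carrier L. \<forall>y\<in>carrier L. x \<sqsubseteq>\<^bsub>L\<^esub> y \<longleftrightarrow> f x \<sqsubseteq>\<^bsub>M\<^esub> f y))"

definition covers :: "('a, 'c) gorder_scheme \<Rightarrow> 'a \<Rightarrow> 'a \<Rightarrow> bool" where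
  "covers L x y \<longleftrightarrow>
     x \<in> carrier L \<and> y \<in> carrier L \<and> x \<sqsubset>\<^bsub>L\<^esub> y \<and>
     \<not> (\<exists>z\<in>carrier L. x \<sqsubset>\<^bsub>L\<^esub> z \<and> z \<sqsubset>\<^bsub>L\<^esub> y)"

definition maximal_chain :: "('a, 'c) gorder_scheme \<Rightarrow> 'a set \<Rightarrow> bool" where
  "maximal_chain L C \<longleftrightarrow> pred_on.maxchain (carrier L) (\<lambda>x y. x \<sqsubset>\<^bsub>L\<^esub> y) C"

text \<open>
  The index set \<open>I\<close> below is either all of \<open>\<nat>\<close> or a finite initial segment, so that maximal chains
  may be infinite or finite. (In an upho lattice with at least two elements they are all infinite.)
\<close>

definition finite_type_N_graded :: "('a, 'c) gorder_scheme \<Rightarrow> bool" where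
  "finite_type_N_graded L \<longleftrightarrow>
     partial_order L \<and>
     (\<exists>x. least L x (carrier L)) \<and>
     (\<exists>\<rho> :: 'a \<Rightarrow> nat.
        \<rho> \<bottom>\<^bsub>L\<^esub> = 0 \<and>
        (\<forall>C. maximal_chain L C \<longrightarrow>
           (\<exists>(x :: nat \<Rightarrow> 'a) I.
              (I = UNIV \<or> (\<exists>n. I = {..n})) \<and>
              C = x ` I \<and> x 0 = \<bottom>\<^bsub>L\<^esub> \<and>
              (\<forall>i. Suc i \<in> I \<longrightarrow> covers L (x i) (x (Suc i))) \<and>
              (\<forall>i\<in>I. \<rho> (x i) = i))) \<and>
        (\<forall>k. finite {x \<in> carrier L. \<rho> x = k}))"

definition principal_filter :: "('a, 'c) gorder_scheme \<Rightarrow> 'a \<Rightarrow> ('a, 'c) gorder_scheme" where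
  "principal_filter L p = L\<lparr>carrier := {q \<in> carrier L. p \<sqsubseteq>\<^bsub>L\<^esub> q}\<rparr>"

definition upho_lattice :: "('a, 'c) gorder_scheme \<Rightarrow> bool" where
  "upho_lattice L \<longleftrightarrow>
     Lattice.lattice L \<and> finite_type_N_graded L \<and>
     (\<exists>x\<in>carrier L. \<exists>y\<in>carrier L. x \<noteq> y) \<and>
     (\<forall>p\<in>carrier L. order_isomorphic (principal_filter L p) L)"

definition atoms :: "('a, 'c) gorder_scheme \<Rightarrow> 'a set" where
  "atoms L = {s. covers L \<bottom>\<^bsub>L\<^esub> s}"

definition core :: "('a, 'c) gorder_scheme \<Rightarrow> ('a, 'c) gorder_scheme" where
  "core L = L\<lparr>carrier := \<lbrace>\<bottom>\<^bsub>L\<^esub>..\<Squnion>\<^bsub>L\<^esub>(atoms L)\<rbrace>\<^bsub>L\<^esub>\<rparr>"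


section \<open>The cross polytope and its face lattice\<close>

text \<open>
  The coordinate permutations of \<open>(\<plusminus>1, 0, \<dots>, 0)\<close> are the vectors having one entry
  \<open>\<plusminus>1\<close>, in an arbitrary coordinate \<open>i\<close>, and zeros elsewhere.
\<close>

definition cross_polytope :: "(real ^ 'n) set" where
  "cross_polytope = convex hull {axis i c | i c. c = 1 \<or> c = -1}"

text \<open>Both the empty set and \<open>P\<close> itself satisfy \<^term>\<open>F face_of P\<close> (for convex \<open>P\<close>).\<close>

definition face_lattice :: "'a::real_vector set \<Rightarrow> 'a set gorder" where
  "face_lattice P = \<lparr>carrier = {F. F face_of P}, eq = (=), le = (\<subseteq>)\<rparr>"

end

theory Submission
  imports Defs
begin

text \<open>
  Suppose the face lattice is the core \<open>[\<bottom>, m]\<close> of an upho lattice. Let \<open>s\<close> be the atom given by a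
  vertex, and let \<open>x\<close> correspond to \<open>m\<close> under an isomorphism \<open>f\<close> from the filter of \<open>s\<close> to the whole
  lattice; then \<open>x\<close> lies above all upper covers of \<open>s\<close>. Since \<open>P\<close> is the smallest face containing all
  edges through a vertex, \<open>m\<close> is the join of the upper covers of \<open>s\<close> below \<open>m\<close>, so \<open>m \<sqsubseteq> x\<close>.
  Hence \<open>f m\<close> belongs to the core, and it has as many atoms below it as there are edges through a
  vertex, namely \<open>2n - 2\<close>. But a face of the cross polytope has \<open>2n\<close> vertices if it is \<open>P\<close> itself,
  and at most \<open>n\<close> otherwise because it contains no two antipodal ones; and \<open>n < 2n - 2 < 2n\<close>.
\<close>

section \<open>Order isomorphisms and covers\<close>

definition order_iso :: "('a \<Rightarrow> 'b) \<Rightarrow> ('a, 'c) gorder_scheme \<Rightarrow> ('b, 'd) gorder_scheme \<Rightarrow> bool" where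
  "order_iso f L M \<longleftrightarrow> bij_betw f (carrier L) (carrier M) \<and>
     (\<forall>x\<in>carrier L. \<forall>y\<in>carrier L. x \<sqsubseteq>\<^bsub>L\<^esub> y \<longleftrightarrow> f x \<sqsubseteq>\<^bsub>M\<^esub> f y)"

lemma order_isomorphic_iff: "order_isomorphic L M \<longleftrightarrow> (\<exists>f. order_iso f L M)"
  by (simp add: order_isomorphic_def order_iso_def)

lemma order_iso_comp:
  assumes "order_iso f L M" "order_iso g M N"
  shows "order_iso (g \<circ> f) L N"
  using assms bij_betw_trans[of f "carrier L" "carrier M" g "carrier N"]
  by (auto simp: order_iso_def bij_betw_apply)

lemma order_iso_closed: "order_iso f L M \<Longrightarrow> x \<in> carrier L \<Longrightarrow> f x \<in> carrier M"
  by (auto simp: order_iso_def bij_betw_apply)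

lemma order_iso_le_iff:
  "order_iso f L M \<Longrightarrow> x \<in> carrier L \<Longrightarrow> y \<in> carrier L \<Longrightarrow> f x \<sqsubseteq>\<^bsub>M\<^esub> f y \<longleftrightarrow> x \<sqsubseteq>\<^bsub>L\<^esub> y"
  by (auto simp: order_iso_def)

lemma order_iso_eq_iff:
  "order_iso f L M \<Longrightarrow> x \<in> carrier L \<Longrightarrow> y \<in> carrier L \<Longrightarrow> f x = f y \<longleftrightarrow> x = y"
  by (auto simp: order_iso_def bij_betw_def inj_on_eq_iff)

lemma order_iso_surjE:
  assumes "order_iso f L M" "y \<in> carrier M"
  obtains x where "x \<in> carrier L" "f x = y"
proof -
  have "y \<in> f ` carrier L" using assms by (simp add: order_iso_def bij_betw_def)
  then show thesis using that by blast
qed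

text \<open>Strictness in \<open>covers\<close> refers to the equality stored in the record, which
  an order isomorphism does not control. Hence both records are assumed to store
  \<open>(=)\<close>.\<close>

lemma order_iso_covers_iff:
  assumes f: "order_iso f L M" and eq: "eq L = (=)" "eq M = (=)"
    and x: "x \<in> carrier L" and y: "y \<in> carrier L"
  shows "covers M (f x) (f y) \<longleftrightarrow> covers L x y"
proof -
  have im: "carrier M = f ` carrier L"
    using f by (auto simp: order_iso_def bij_betw_def)
  have less: "f u \<sqsubset>\<^bsub>M\<^esub> f v \<longleftrightarrow> u \<sqsubset>\<^bsub>L\<^esub> v" if "u \<in> carrier L" "v \<in> carrier L" for u v
    using that order_iso_le_iff[OF f that] order_iso_eq_iff[OF f that] by (simp add: lless_def eq)
  show ?thesis
    using x y by (auto simp: covers_def im less)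
qed

lemma covers_closed: "covers L x y \<Longrightarrow> x \<in> carrier L \<and> y \<in> carrier L"
  by (simp add: covers_def)

lemma covers_le: "covers L x y \<Longrightarrow> x \<sqsubseteq>\<^bsub>L\<^esub> y"
  by (simp add: covers_def lless_def)

text \<open>The last assumption keeps the whole interval from \<open>x\<close> to \<open>y\<close>
  inside \<open>A\<close>, so no intermediate element is lost. It holds for down-sets (the core) and
  for up-sets (principal filters).\<close>

lemma covers_carrier_update:
  assumes "A \<subseteq> carrier L" "x \<in> A" "y \<in> A"
    and "\<And>z. z \<in> carrier L \<Longrightarrow> x \<sqsubseteq>\<^bsub>L\<^esub> z \<Longrightarrow> z \<sqsubseteq>\<^bsub>L\<^esub> y \<Longrightarrow> z \<in> A"
  shows "covers (L\<lparr>carrier := A\<rparr>) x y \<longleftrightarrow> covers L x y"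
  using assms by (auto simp: covers_def lless_def)

lemma (in partial_order) order_iso_least:
  assumes f: "order_iso f K (L\<lparr>carrier := A\<rparr>)" and A: "A \<subseteq> carrier L"
    and "least K b (carrier K)" "c \<in> A" "\<And>a. a \<in> A \<Longrightarrow> c \<sqsubseteq> a"
  shows "f b = c"
proof -
  have b: "b \<in> carrier K" using assms(3) by simp
  obtain c' where c': "c' \<in> carrier K" "f c' = c"
    using order_iso_surjE[OF f, of c] assms by auto
  have "b \<sqsubseteq>\<^bsub>K\<^esub> c'" using assms(3) c' by (simp add: least_def)
  then have "f b \<sqsubseteq> c" using order_iso_le_iff[OF f b c'(1)] c' by simp
  moreover have "f b \<in> A" using order_iso_closed[OF f b] by simp
  ultimately show ?thesis using assms A by (meson le_antisym subsetD)
qed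

lemma (in partial_order) order_iso_greatest:
  assumes f: "order_iso f K (L\<lparr>carrier := A\<rparr>)" and A: "A \<subseteq> carrier L"
    and "greatest K t (carrier K)" "c \<in> A" "\<And>a. a \<in> A \<Longrightarrow> a \<sqsubseteq> c"
  shows "f t = c"
proof -
  have t: "t \<in> carrier K" using assms(3) by simp
  obtain c' where c': "c' \<in> carrier K" "f c' = c"
    using order_iso_surjE[OF f, of c] assms by auto
  have "c' \<sqsubseteq>\<^bsub>K\<^esub> t" using assms(3) c' by (simp add: greatest_def)
  then have "c \<sqsubseteq> f t" using order_iso_le_iff[OF f c'(1) t] c' by simp
  moreover have "f t \<in> A" using order_iso_closed[OF f t] by simp
  ultimately show ?thesis using assms A by (meson le_antisym subsetD)
qed


section \<open>Upho lattices and their cores\<close>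

lemma (in partial_order) maximal_chain_through:
  assumes s: "s \<in> carrier L"
  obtains C where "maximal_chain L C" "s \<in> C"
proof -
  let ?R = "\<lambda>x y. x \<sqsubset>\<^bsub>L\<^esub> y"
  \<comment> \<open>\<open>A\<close> consists of the elements comparable with \<open>s\<close>. A
    maximal chain of \<open>A\<close> must contain \<open>s\<close>, and every chain of
    \<open>L\<close> that extends it contains \<open>s\<close> too and therefore stays inside
    \<open>A\<close>.\<close>
  define A where "A = {z \<in> carrier L. z = s \<or> s \<sqsubset> z \<or> z \<sqsubset> s}"
  obtain C where C: "pred_on.maxchain A ?R C"
    using pred_on.Hausdorff by blast
  have CA: "pred_on.chain A ?R C"
    using C by (simp add: pred_on.maxchain_def)
  have sC: "s \<in> C"
  proof (rule ccontr)
    assume "s \<notin> C"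
    moreover have "pred_on.chain A ?R (insert s C)"
      using CA s by (auto simp: pred_on.chain_def A_def)
    ultimately show False
      using C by (auto simp: pred_on.maxchain_def)
  qed
  have "pred_on.chain (carrier L) ?R C"
    using CA by (auto simp: pred_on.chain_def A_def)
  moreover have False if D: "pred_on.chain (carrier L) ?R D" "C \<subset> D" for D
  proof -
    have DL: "D \<subseteq> carrier L" and cmp: "\<And>x y. x \<in> D \<Longrightarrow> y \<in> D \<Longrightarrow> x = y \<or> x \<sqsubset> y \<or> y \<sqsubset> x"
      using D(1) unfolding pred_on.chain_def by blast+
    have "s \<in> D" using D(2) sC by blast
    then have "D \<subseteq> A" using DL cmp unfolding A_def by blast
    then have "pred_on.chain A ?R D"
      using D(1) unfolding pred_on.chain_def by blast
    then show False
      using C D(2) by (auto simp: pred_on.maxchain_def)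
  qed
  ultimately have "maximal_chain L C"
    by (auto simp: maximal_chain_def pred_on.maxchain_def)
  then show thesis using sC that by blast
qed

text \<open>The rank function is described only along maximal chains. An atom lies on such a chain,
  necessarily at index 1, so it has rank 1, and each rank occurs finitely often. Finiteness ensures
  that the join of the atoms exists.\<close>

lemma finite_atoms:
  fixes L (structure)
  assumes "finite_type_N_graded L"
  shows "finite (atoms L)"
proof -
  from assms obtain \<rho> where po: "partial_order L" and \<rho>0: "\<rho> \<bottom> = (0::nat)"
    and chain: "\<And>C. maximal_chain L C \<Longrightarrow>
           (\<exists>(x :: nat \<Rightarrow> _) I.
              (I = UNIV \<or> (\<exists>n. I = {..n})) \<and>
              C = x ` I \<and> x 0 = \<bottom> \<and>
              (\<forall>i. Suc i \<in> I \<longrightarrow> covers L (x i) (x (Suc i))) \<and>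
              (\<forall>i\<in>I. \<rho> (x i) = i))"
    and fin: "\<And>k. finite {x \<in> carrier L. \<rho> x = k}"
    unfolding finite_type_N_graded_def by blast
  interpret partial_order L by (rule po)
  have "\<rho> s = 1 \<and> s \<in> carrier L" if "s \<in> atoms L" for s
  proof -
    have s: "covers L \<bottom> s" using that by (simp add: atoms_def)
    then have sL: "s \<in> carrier L" and ne: "s \<noteq> \<bottom>"
      by (auto simp: covers_def lless_def eq_is_equal)
    obtain C where C: "maximal_chain L C" "s \<in> C"
      using maximal_chain_through[OF sL] by blast
    obtain x :: "nat \<Rightarrow> _" and I where I: "I = UNIV \<or> (\<exists>n. I = {..n})" and CI: "C = x ` I"
      and x0: "x 0 = \<bottom>"
      and cov: "\<And>i. Suc i \<in> I \<Longrightarrow> covers L (x i) (x (Suc i))"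
      and r: "\<And>i. i \<in> I \<Longrightarrow> \<rho> (x i) = i"
      using chain[OF C(1)] by blast
    obtain i where i: "i \<in> I" "s = x i" using C CI by blast
    have down: "j \<in> I" if "j \<le> i" for j using I i that by auto
    have "i = 1"
    \<comment> \<open>If \<open>i\<close> were at least 2, then \<open>x 1\<close> would lie
      strictly between \<open>\<bottom>\<close> and \<open>s\<close>; it differs from
      \<open>s\<close> because the ranks 1 and \<open>i\<close> differ.\<close>
    proof (rule ccontr)
      assume "i \<noteq> 1"
      moreover have "i \<noteq> 0" using ne x0 i by metis
      ultimately obtain j where j: "i = Suc (Suc j)" by (metis One_nat_def not0_implies_Suc)
      have car: "x k \<in> carrier L" if "k \<le> i" for k
        using cov[of k] cov[of "k - 1"] down[OF that] that down sL i
        by (metis Suc_leI covers_closed le_neq_implies_less)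
      have le1: "x 1 \<sqsubseteq> x (Suc k)" if "Suc k \<le> i" for k
        using that
      proof (induction k)
        case 0
        then show ?case using car by simp
      next
        case (Suc k)
        have "x (Suc k) \<sqsubseteq> x (Suc (Suc k))"
          using covers_le[OF cov[OF down[OF Suc.prems]]] .
        moreover have "x 1 \<sqsubseteq> x (Suc k)" using Suc by simp
        ultimately show ?case
          using le_trans[OF _ _ car[of 1] car[of "Suc k"] car[of "Suc (Suc k)"]] Suc.prems by simp
      qed
      have "1 \<le> i" using j by simp
      have "x 1 \<sqsubseteq> s" using le1[of "Suc j"] i j by simp
      moreover have "x 1 \<noteq> s" using r[OF down[OF \<open>1 \<le> i\<close>]] r[OF i(1)] i(2) \<open>i \<noteq> 1\<close> by metis
      moreover have "\<bottom> \<sqsubset> x 1" using cov[of 0] down[OF \<open>1 \<le> i\<close>] x0 by (simp add: covers_def)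
      ultimately show False
        using s car[OF \<open>1 \<le> i\<close>] by (auto simp: covers_def lless_def eq_is_equal)
    qed
    then show ?thesis using r[OF i(1)] i sL by simp
  qed
  then have "atoms L \<subseteq> {x \<in> carrier L. \<rho> x = 1}" by auto
  then show ?thesis using fin finite_subset by blast
qed

text \<open>All the lattice theory is isolated here, for any poset \<open>K\<close> isomorphic to
  the core. An isomorphism from the filter of an atom \<open>s\<close> to \<open>L\<close> carries
  the interval from \<open>s\<close> to \<open>m\<close> onto the interval from
  \<open>\<bottom>\<close> to \<open>f m\<close>; assumption \<open>join\<close> forces
  \<open>f m\<close> into the core, so both sides can be counted in \<open>K\<close>.\<close>

lemma upho_core_atom_count:
  fixes L :: "('a, 'c) gorder_scheme" (structure) and K :: "('b, 'd) gorder_scheme"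
  assumes upho: "upho_lattice L" and iso: "order_isomorphic K (core L)" and eqK: "eq K = (=)"
    and b: "least K b (carrier K)" and t: "greatest K t (carrier K)" and p: "covers K b p"
    and join: "\<And>u. u \<in> carrier K \<Longrightarrow> (\<And>v. covers K p v \<Longrightarrow> v \<sqsubseteq>\<^bsub>K\<^esub> u) \<Longrightarrow> t \<sqsubseteq>\<^bsub>K\<^esub> u"
  shows "\<exists>u\<in>carrier K. card {a. covers K b a \<and> a \<sqsubseteq>\<^bsub>K\<^esub> u} = card {v. covers K p v}"
proof -
  have lat: "Lattice.lattice L" and graded: "finite_type_N_graded L"
    and filt: "\<And>p. p \<in> carrier L \<Longrightarrow> order_isomorphic (principal_filter L p) L"
    using upho by (auto simp: upho_lattice_def)
  interpret Lattice.lattice L by (rule lat)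
  have eqL: "eq L = (=)" by (rule eq_is_equal)
  define m where "m = \<Squnion>(atoms L)"
  define C where "C = \<lbrace>\<bottom>..m\<rbrace>\<^bsub>L\<^esub>"
  have core: "core L = L\<lparr>carrier := C\<rparr>" by (simp add: core_def C_def m_def)
  have "\<exists>x. least L x (carrier L)" using graded by (simp add: finite_type_N_graded_def)
  then have bot: "least L \<bottom> (carrier L)" unfolding bottom_def by (rule someI_ex)
  then have botL: "\<bottom> \<in> carrier L" and bot_le: "\<And>x. x \<in> carrier L \<Longrightarrow> \<bottom> \<sqsubseteq> x"
    by (auto simp: least_def)
  have atL: "atoms L \<subseteq> carrier L" by (auto simp: atoms_def covers_def)
  have mlub: "least L m (Upper L (atoms L))"
  \<comment> \<open>A lattice provides joins of finite nonempty sets. For the empty set,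
    \<open>m\<close> unfolds to the same choice of a least element as
    \<open>\<bottom>\<close>.\<close>
  proof (cases "atoms L = {}")
    case True
    then show ?thesis using bot by (simp add: m_def sup_def bottom_def)
  next
    case False
    then show ?thesis unfolding m_def using finite_sup_least[OF finite_atoms[OF graded] atL] by simp
  qed
  then have mL: "m \<in> carrier L" by (meson Upper_closed least_mem subsetD)
  have at_le: "a \<sqsubseteq> m" if "covers L \<bottom> a" for a
    using least_Upper_above[OF mlub _ atL] that by (simp add: atoms_def)
  have Cmem: "z \<in> C \<longleftrightarrow> z \<in> carrier L \<and> z \<sqsubseteq> m" for z
    using bot_le by (auto simp: C_def at_least_at_most_def)
  have CL: "C \<subseteq> carrier L" using Cmem by auto
  have Ccov: "covers (core L) y z \<longleftrightarrow> covers L y z" if "y \<in> C" "z \<in> C" for y z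
    unfolding core using that by (intro covers_carrier_update) (auto simp: Cmem intro: le_trans mL)
  obtain g where g: "order_iso g K (L\<lparr>carrier := C\<rparr>)"
    using iso by (auto simp: order_isomorphic_iff core)
  have gC: "g u \<in> C" if "u \<in> carrier K" for u using order_iso_closed[OF g that] by simp
  have gle: "g u \<sqsubseteq> g v \<longleftrightarrow> u \<sqsubseteq>\<^bsub>K\<^esub> v" if "u \<in> carrier K" "v \<in> carrier K" for u v
    using order_iso_le_iff[OF g that] by simp
  have ginv: "\<exists>u\<in>carrier K. g u = z" if "z \<in> C" for z
    using order_iso_surjE[OF g, of z] that by auto
  have gcov: "covers L (g u) (g v) \<longleftrightarrow> covers K u v" if "u \<in> carrier K" "v \<in> carrier K" for u v
    using order_iso_covers_iff[OF g eqK _ that] Ccov[OF gC gC, OF that] eqL by (simp add: core)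
  have bK: "b \<in> carrier K" and tK: "t \<in> carrier K" using b t by auto
  have gb: "g b = \<bottom>"
    by (rule order_iso_least[OF g CL b]) (auto simp: Cmem botL bot_le mL)
  have gt: "g t = m"
    by (rule order_iso_greatest[OF g CL t]) (auto simp: Cmem mL)
  have pK: "p \<in> carrier K" using p by (simp add: covers_def)
  define s where "s = g p"
  have sL: "s \<in> carrier L" and sm: "s \<sqsubseteq> m" using gC[OF pK] by (auto simp: s_def Cmem)
  define F where "F = {q \<in> carrier L. s \<sqsubseteq> q}"
  have filter: "principal_filter L s = L\<lparr>carrier := F\<rparr>" by (simp add: principal_filter_def F_def)
  have Fcov: "covers (L\<lparr>carrier := F\<rparr>) s z \<longleftrightarrow> covers L s z" if "z \<in> F" for z
    using that sL by (intro covers_carrier_update) (auto simp: F_def)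
  obtain f where f: "order_iso f (L\<lparr>carrier := F\<rparr>) L"
    using filt[OF sL] by (auto simp: order_isomorphic_iff filter)
  have sF: "s \<in> F" using sL by (simp add: F_def)
  have FL: "F \<subseteq> carrier L" by (auto simp: F_def)
  have fL: "f z \<in> carrier L" if "z \<in> F" for z using order_iso_closed[OF f] that by simp
  have fle: "f y \<sqsubseteq> f z \<longleftrightarrow> y \<sqsubseteq> z" if "y \<in> F" "z \<in> F" for y z
    using order_iso_le_iff[OF f] that by simp
  have fs: "f s = \<bottom>"
  proof -
    \<comment> \<open>The trivial carrier update brings the target into the form required by
      \<open>order_iso_least\<close>.\<close>
    have "order_iso f (L\<lparr>carrier := F\<rparr>) (L\<lparr>carrier := carrier L\<rparr>)"
      using f by (simp add: order_iso_def)
    then show ?thesis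
      using order_iso_least[of f "L\<lparr>carrier := F\<rparr>" "carrier L" s \<bottom>] sF botL bot_le
      by (auto simp: least_def F_def)
  qed
  have fcov: "covers L \<bottom> (f z) \<longleftrightarrow> covers L s z" if "z \<in> F" for z
    using order_iso_covers_iff[OF f, of s z] Fcov[OF that] that sF fs eqL by simp
  have covF: "z \<in> F" if "covers L s z" for z
    using that covers_closed covers_le by (fastforce simp: F_def)
  have finv: "\<exists>z\<in>F. f z = y" if "y \<in> carrier L" for y
    using order_iso_surjE[OF f that] by auto
  obtain x where x: "x \<in> F" "f x = m" using finv[OF mL] by blast
  have xL: "x \<in> carrier L" using x FL by blast
  have cov_x: "z \<sqsubseteq> x" if "covers L s z" for z
    using at_le[of "f z"] fcov[OF covF[OF that]] fle[OF covF[OF that] x(1)] that x(2) by simp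
  \<comment> \<open>Assumption \<open>join\<close> speaks only of elements of \<open>K\<close>,
    while \<open>x\<close> may lie outside the core. The meet with \<open>m\<close> lies in the core
    and is still above every upper cover of \<open>s\<close> that is below \<open>m\<close>.\<close>
  have wL: "m \<sqinter> x \<in> carrier L" using mL xL by simp
  have wm: "m \<sqinter> x \<sqsubseteq> m" and wx: "m \<sqinter> x \<sqsubseteq> x" using meet_left meet_right mL xL by auto
  obtain u where u: "u \<in> carrier K" "g u = m \<sqinter> x"
    using ginv[of "m \<sqinter> x"] wL wm Cmem by auto
  have "v \<sqsubseteq>\<^bsub>K\<^esub> u" if "covers K p v" for v
  proof -
    have v: "v \<in> carrier K" using that by (simp add: covers_def)
    have "g v \<sqsubseteq> x" using cov_x gcov[OF pK v] that by (simp add: s_def)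
    moreover have "g v \<sqsubseteq> m" "g v \<in> carrier L" using gC[OF v] by (auto simp: Cmem)
    ultimately have "g v \<sqsubseteq> g u" using meet_le mL xL u by simp
    then show ?thesis using gle[OF v u(1)] by simp
  qed
  then have "t \<sqsubseteq>\<^bsub>K\<^esub> u" using join u by blast
  then have "m \<sqsubseteq> m \<sqinter> x" using gle[OF tK u(1)] gt u by simp
  then have mx: "m \<sqsubseteq> x" using wx wL mL xL le_trans by blast
  have mF: "m \<in> F" using mL sm by (simp add: F_def)
  have "f m \<sqsubseteq> m" using fle[OF mF x(1)] mx x by simp
  then obtain w where w: "w \<in> carrier K" "g w = f m"
    using ginv[of "f m"] fL[OF mF] Cmem by auto
  let ?V = "{v. covers K p v}" and ?A = "{a. covers K b a \<and> a \<sqsubseteq>\<^bsub>K\<^esub> w}"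
  have VK: "?V \<subseteq> carrier K" and AK: "?A \<subseteq> carrier K" by (auto simp: covers_def)
  \<comment> \<open>Three bijections link the counts: \<open>g\<close> from \<open>?V\<close> to the
    upper covers of \<open>s\<close> below \<open>m\<close>, \<open>f\<close> from these to the
    atoms below \<open>f m\<close>, and \<open>g\<close> from \<open>?A\<close> to the same
    atoms.\<close>
  have gV: "g ` ?V = {z. covers L s z \<and> z \<sqsubseteq> m}"
  proof safe
    fix v assume v: "covers K p v"
    then have "v \<in> carrier K" by (simp add: covers_def)
    then show "covers L s (g v)" "g v \<sqsubseteq> m"
      using v gcov pK gC by (auto simp: s_def Cmem)
  next
    fix z assume z: "covers L s z" "z \<sqsubseteq> m"
    then obtain v where "v \<in> carrier K" "g v = z"
      using ginv[of z] covers_closed Cmem by metis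
    then show "z \<in> g ` ?V" using gcov[OF pK] z by (auto simp: s_def)
  qed
  have gA: "g ` ?A = {a. covers L \<bottom> a \<and> a \<sqsubseteq> f m}"
  proof safe
    fix a assume a: "covers K b a" "a \<sqsubseteq>\<^bsub>K\<^esub> w"
    then have "a \<in> carrier K" by (simp add: covers_def)
    then show "covers L \<bottom> (g a)" "g a \<sqsubseteq> f m"
      using a gcov[OF bK] gb gle[OF _ w(1)] w(2) by auto
  next
    fix z assume z: "covers L \<bottom> z" "z \<sqsubseteq> f m"
    then obtain v where "v \<in> carrier K" "g v = z"
      using ginv[of z] covers_closed[of L \<bottom> z] Cmem at_le by metis
    then show "z \<in> g ` ?A" using gcov[OF bK] gb gle[OF _ w(1)] w z by auto
  qed
  have fgV: "f ` {z. covers L s z \<and> z \<sqsubseteq> m} = {a. covers L \<bottom> a \<and> a \<sqsubseteq> f m}"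
  proof safe
    fix z assume "covers L s z" "z \<sqsubseteq> m"
    then show "covers L \<bottom> (f z)" "f z \<sqsubseteq> f m" using covF fcov fle mF by auto
  next
    fix a assume a: "covers L \<bottom> a" "a \<sqsubseteq> f m"
    then obtain z where "z \<in> F" "f z = a" using finv covers_closed by metis
    then show "a \<in> f ` {z. covers L s z \<and> z \<sqsubseteq> m}" using a fcov fle mF by auto
  qed
  have inj: "inj_on g (carrier K)" "inj_on f F"
    using f g by (auto simp: order_iso_def bij_betw_def)
  have "card ?V = card (g ` ?V)"
    using inj_on_subset[OF inj(1) VK] by (simp add: card_image)
  also have "\<dots> = card (f ` {z. covers L s z \<and> z \<sqsubseteq> m})"
    unfolding gV by (rule card_image[symmetric], rule inj_on_subset[OF inj(2)]) (use covF in auto)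
  also have "\<dots> = card ?A"
    unfolding fgV gA[symmetric] using inj_on_subset[OF inj(1) AK] by (simp add: card_image)
  finally show ?thesis using w(1) by auto
qed


section \<open>Faces of the cross polytope as sets of vertices\<close>

definition vert :: "'n \<times> bool \<Rightarrow> real ^ 'n" where
  "vert p = axis (fst p) (if snd p then 1 else -1)"

definition antipodal_free :: "('n \<times> bool) set \<Rightarrow> bool" where
  "antipodal_free U \<longleftrightarrow> (\<forall>i. \<not> ((i, True) \<in> U \<and> (i, False) \<in> U))"

text \<open>A combinatorial model of the face lattice: \<open>UNIV\<close> stands for the polytope
  itself, and the antipodal-free sets are the vertex sets of its proper faces, the empty face
  included.\<close>

definition vertex_set_poset :: "('n \<times> bool) set gorder" where
  "vertex_set_poset = \<lparr>carrier = {U. U = UNIV \<or> antipodal_free U}, eq = (=), le = (\<subseteq>)\<rparr>"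

section \<open>Vertices and faces of the cross polytope\<close>

lemma cross_polytope_eq: "cross_polytope = convex hull (range vert)"
proof -
  have "{axis i c | i c. c = 1 \<or> c = -1} = range (vert :: 'a \<times> bool \<Rightarrow> real ^ 'a)"
  proof safe
    fix i :: 'a
    show "axis i 1 \<in> range (vert :: 'a \<times> bool \<Rightarrow> real ^ 'a)"
      by (rule image_eqI[of _ _ "(i, True)"]) (simp_all add: vert_def)
    show "axis i (- 1) \<in> range (vert :: 'a \<times> bool \<Rightarrow> real ^ 'a)"
      by (rule image_eqI[of _ _ "(i, False)"]) (simp_all add: vert_def)
  qed (auto simp: vert_def)
  then show ?thesis by (simp add: cross_polytope_def)
qed

lemma vert_in_cross_polytope: "vert p \<in> cross_polytope"
  by (simp add: cross_polytope_eq hull_inc)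

lemma convex_cross_polytope: "convex (cross_polytope :: (real ^ 'n) set)"
  by (simp add: cross_polytope_eq)

text \<open>A face of the convex hull of a compact set is the hull of a subset of that set; the
  other inclusion is convexity of the face. Faces are thus determined by their vertices.\<close>

lemma face_eq_hull_vertices:
  assumes "F face_of cross_polytope"
  shows "F = convex hull (vert ` {p. vert p \<in> F})"
proof -
  have "compact (range (vert :: 'a \<times> bool \<Rightarrow> real ^ 'a))"
    by (simp add: finite_imp_compact)
  then obtain S where S: "S \<subseteq> range vert" "F = convex hull S"
    using face_of_convex_hull_subset[of "range vert" F] assms by (auto simp: cross_polytope_eq)
  have "S \<subseteq> vert ` {p. vert p \<in> F}" using S hull_inc by fastforce
  then have "F \<subseteq> convex hull (vert ` {p. vert p \<in> F})" using S hull_mono by blast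
  moreover have "convex hull (vert ` {p. vert p \<in> F}) \<subseteq> F"
    using face_of_imp_convex[OF assms] by (intro hull_minimal) auto
  ultimately show ?thesis by blast
qed

text \<open>
  The face with vertex set \<open>U\<close> is cut out by the hyperplane normal to the sum \<open>a\<close> of its vertices.
\<close>
lemma ex_face_antipodal_free:
  assumes "antipodal_free U"
  obtains F where "F face_of cross_polytope" "{p. vert p \<in> F} = U"
proof -
  define a :: "real ^ 'a" where
    "a = (\<chi> i. if (i, True) \<in> U then 1 else if (i, False) \<in> U then -1 else 0)"
  have a: "a $ i = (if (i, True) \<in> U then 1 else if (i, False) \<in> U then -1 else 0)" for i
    by (simp add: a_def)
  have inn: "a \<bullet> vert (i, c) = (if c then a $ i else - a $ i)" for i c
    by (simp add: vert_def inner_axis)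
  have le: "a \<bullet> vert p \<le> 1" for p
    by (cases p) (simp add: inn a)
  \<comment> \<open>Were both \<open>(i, True)\<close> and \<open>(i, False)\<close> in
    \<open>U\<close>, the first case in \<open>a\<close> would win and the second vertex would have
    inner product -1; \<open>antipodal_free\<close> excludes this.\<close>
  have eq: "a \<bullet> vert p = 1 \<longleftrightarrow> p \<in> U" for p
    using assms by (cases p) (auto simp: inn a antipodal_free_def)
  have "cross_polytope \<subseteq> {x. a \<bullet> x \<le> 1}"
    unfolding cross_polytope_eq by (rule hull_minimal) (auto simp: le convex_halfspace_le)
  then have "(cross_polytope \<inter> {x. a \<bullet> x = 1}) face_of cross_polytope"
    by (intro face_of_Int_supporting_hyperplane_le convex_cross_polytope) auto
  moreover have "{p. vert p \<in> cross_polytope \<inter> {x. a \<bullet> x = 1}} = U"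
    using vert_in_cross_polytope eq by auto
  ultimately show thesis by (rule that)
qed

text \<open>Two antipodal vertices have midpoint \<open>0\<close>, which is also the midpoint of all other antipodal pairs.\<close>
lemma vertices_of_face:
  assumes F: "F face_of cross_polytope"
  shows "{p. vert p \<in> F} = UNIV \<or> antipodal_free {p. vert p \<in> F}"
proof (rule disjCI)
  have mid: "0 \<in> open_segment (vert (j, True)) (vert (j, False))" for j :: 'a
  proof -
    have neg: "vert (j, False) = - vert (j, True)"
      by (simp add: vert_def axis_def vec_eq_iff)
    have "vert (j, True) \<noteq> 0" by (simp add: vert_def axis_eq_0_iff)
    then have "vert (j, True) \<noteq> vert (j, False)" by (simp add: neg eq_neg_iff_add_eq_0 flip: scaleR_2)
    then show ?thesis
      using midpoint_in_open_segment[of "vert (j, True)" "vert (j, False)"]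
      by (simp add: neg midpoint_def)
  qed
  assume "\<not> antipodal_free {p. vert p \<in> F}"
  then obtain i where "vert (i, True) \<in> F" "vert (i, False) \<in> F"
    by (auto simp: antipodal_free_def)
  then have zero: "0 \<in> F"
    using face_of_imp_convex[OF F] mid[of i] convex_contains_open_segment by blast
  have "vert (j, c) \<in> F" for j c
    using face_ofD[OF F mid[of j] vert_in_cross_polytope vert_in_cross_polytope zero]
    by (cases c) auto
  then show "{p. vert p \<in> F} = UNIV" by auto
qed

text \<open>The inverse map sends a face to the set of its vertices. That the hull of an admissible
  \<open>U\<close> is a face with no further vertices follows from the supporting hyperplane
  constructed for \<open>U\<close>, or trivially if \<open>U\<close> is \<open>UNIV\<close>.\<close>

lemma order_iso_vertex_set_poset:
  "order_iso (\<lambda>U. convex hull (vert ` U)) vertex_set_poset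
     (face_lattice (cross_polytope :: (real ^ 'n) set))"
proof -
  let ?h = "\<lambda>U. convex hull (vert ` U) :: (real ^ 'n) set"
  have ver: "?h U face_of cross_polytope \<and> {p. vert p \<in> ?h U} = U"
    if "U = UNIV \<or> antipodal_free U" for U
  proof (cases "U = UNIV")
    case True
    then show ?thesis
      by (simp add: cross_polytope_eq face_of_refl hull_inc)
  next
    case False
    then obtain F :: "(real ^ 'n) set" where "F face_of cross_polytope" "{p. vert p \<in> F} = U"
      using ex_face_antipodal_free \<open>U = UNIV \<or> _\<close> by metis
    then show ?thesis using face_eq_hull_vertices by metis
  qed
  have "bij_betw ?h {U. U = UNIV \<or> antipodal_free U} {F. F face_of cross_polytope}"
    by (rule bij_betw_byWitness[where f' = "\<lambda>F. {p. vert p \<in> F}"])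
      (use ver vertices_of_face face_eq_hull_vertices in blast)+
  moreover have "U \<subseteq> V \<longleftrightarrow> ?h U \<subseteq> ?h V"
    if "U = UNIV \<or> antipodal_free U" "V = UNIV \<or> antipodal_free V" for U V
    using ver[OF that(1)] ver[OF that(2)] hull_mono[of "vert ` U" "vert ` V"] by blast
  ultimately show ?thesis
    by (simp add: order_iso_def vertex_set_poset_def face_lattice_def)
qed

text \<open>Such a set contains at most one sign per coordinate, so the projection to coordinates is
  injective on it.\<close>

lemma card_antipodal_free:
  fixes U :: "('n::finite \<times> bool) set"
  assumes "antipodal_free U"
  shows "card U \<le> CARD('n)"
proof -
  have "inj_on fst U"
    using assms by (auto simp: inj_on_def antipodal_free_def) (metis (full_types))+
  then show ?thesis
    using card_inj_on_le[of fst U "UNIV :: 'n set"] by simp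
qed

section \<open>Atoms and edges in the poset of vertex sets\<close>

lemma covers_vertex_set_poset_empty:
  "covers (vertex_set_poset :: ('n::finite \<times> bool) set gorder) {} V \<longleftrightarrow> (\<exists>q. V = {q})"
proof
  have single: "antipodal_free {q :: 'n \<times> bool}" for q
    by (auto simp: antipodal_free_def)
  {
    assume V: "covers vertex_set_poset {} V"
    then obtain q where "q \<in> V" by (auto simp: covers_def lless_def vertex_set_poset_def)
    then have "\<not> {q} \<subset> V"
      using V single[of q] unfolding covers_def lless_def vertex_set_poset_def by auto
    with \<open>q \<in> V\<close> have "V = {q}" by blast
    then show "\<exists>q. V = {q}" ..
  }
  assume "\<exists>q. V = {q}"
  then show "covers vertex_set_poset {} V"
    using single by (auto simp: covers_def lless_def vertex_set_poset_def antipodal_free_def)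
qed

lemma ex_other_element:
  assumes "CARD('a::finite) \<ge> 2"
  shows "\<exists>j. j \<noteq> (i :: 'a)"
proof (rule ccontr)
  assume "\<nexists>j. j \<noteq> i"
  then have "UNIV = {i}" by blast
  then have "CARD('a) = card {i}" by (rule arg_cong)
  then show False using assms by simp
qed

text \<open>A vertex is joined by an edge to every other vertex except its antipode. In dimension 1
  this fails, since there \<open>UNIV\<close> itself covers a vertex.\<close>

lemma covers_vertex_set_poset_singleton:
  fixes i :: "'n::finite"
  assumes "CARD('n) \<ge> 2"
  shows "covers vertex_set_poset {(i, True)} V \<longleftrightarrow> (\<exists>q. fst q \<noteq> i \<and> V = {(i, True), q})"
proof
  have pair: "antipodal_free {(i, True), q}" if "fst q \<noteq> i" for q
    using that by (auto simp: antipodal_free_def)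
  obtain j where j: "j \<noteq> i" using ex_other_element[OF assms] by blast
  {
    assume V: "covers vertex_set_poset {(i, True)} V"
    then have sub: "(i, True) \<in> V" "V \<noteq> {(i, True)}" and V': "V = UNIV \<or> antipodal_free V"
      by (auto simp: covers_def lless_def vertex_set_poset_def)
    \<comment> \<open>A second coordinate \<open>j\<close> supplies \<open>q\<close> if
      \<open>V\<close> is everything; otherwise any further element of \<open>V\<close> works, as it
      cannot be the antipode.\<close>
    obtain q where q: "q \<in> V" "fst q \<noteq> i"
    proof (cases "V = UNIV")
      case True
      then show thesis using that[of "(j, True)"] j by simp
    next
      case False
      obtain q where "q \<in> V" "q \<noteq> (i, True)" using sub by blast
      moreover have "q \<noteq> (i, False)" using False V' sub calculation by (auto simp: antipodal_free_def)
      ultimately show thesis using that[of q] by (cases q) (metis (full_types) fst_conv)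
    qed
    then have "(i, True) \<noteq> q" "{(i, True), q} \<subseteq> V" using sub by auto
    moreover have "\<not> {(i, True), q} \<subset> V"
      using V pair[OF q(2)] \<open>(i, True) \<noteq> q\<close> unfolding covers_def lless_def vertex_set_poset_def by auto
    ultimately have "V = {(i, True), q}" by blast
    then show "\<exists>q. fst q \<noteq> i \<and> V = {(i, True), q}" using q by blast
  }
  assume "\<exists>q. fst q \<noteq> i \<and> V = {(i, True), q}"
  then obtain q where q: "fst q \<noteq> i" "V = {(i, True), q}" by blast
  then show "covers vertex_set_poset {(i, True)} V"
    using pair[OF q(1)]
    by (auto simp: covers_def lless_def vertex_set_poset_def antipodal_free_def)
qed

theorem theorem5p12:
  fixes P :: "(real ^ 'n) set"
  assumes "CARD('n) \<ge> 3"
    and "P = cross_polytope"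
  shows "\<not> (\<exists>L :: 'b gorder. upho_lattice L \<and> order_isomorphic (face_lattice P) (core L))"
proof
  assume "\<exists>L :: 'b gorder. upho_lattice L \<and> order_isomorphic (face_lattice P) (core L)"
  then obtain L :: "'b gorder" where L: "upho_lattice L" "order_isomorphic (face_lattice P) (core L)"
    by blast
  let ?K = "vertex_set_poset :: ('n \<times> bool) set gorder"
  have n2: "CARD('n) \<ge> 2" using assms by simp
  obtain i :: 'n where True by blast
  let ?p = "(i, True)" and ?Q = "{q :: 'n \<times> bool. fst q \<noteq> i}"
  note cov = covers_vertex_set_poset_singleton[OF n2, of i]
  have K: "U \<in> carrier ?K \<longleftrightarrow> U = UNIV \<or> antipodal_free U" "U \<sqsubseteq>\<^bsub>?K\<^esub> V \<longleftrightarrow> U \<subseteq> V" for U V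
    by (auto simp: vertex_set_poset_def)
  have iso: "order_isomorphic ?K (core L)"
    using L(2) order_iso_comp order_iso_vertex_set_poset unfolding assms(2) order_isomorphic_iff by blast
  have Q: "?Q = (UNIV - {i}) \<times> UNIV" by auto
  have cardQ: "card ?Q = 2 * (CARD('n) - 1)"
    unfolding Q by (simp add: card_cartesian_product card_Diff_singleton)
  \<comment> \<open>This is the \<open>join\<close> assumption: the edges through \<open>?p\<close>
    reach both signs of another coordinate \<open>j\<close>, and a face with an antipodal pair is
    the whole polytope.\<close>
  have top: "UNIV \<subseteq> U" if U: "U \<in> carrier ?K" and le: "\<And>V. covers ?K {?p} V \<Longrightarrow> V \<sqsubseteq>\<^bsub>?K\<^esub> U" for U
  proof -
    have QU: "?Q \<subseteq> U"
    proof
      fix q assume "q \<in> ?Q"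
      then have "covers ?K {?p} {?p, q}" unfolding cov by blast
      then have "{?p, q} \<subseteq> U" using le by (simp only: K)
      then show "q \<in> U" by simp
    qed
    obtain j where "j \<noteq> i" using ex_other_element[OF n2] by blast
    then have "(j, True) \<in> U" "(j, False) \<in> U" using QU by auto
    then have "\<not> antipodal_free U" by (auto simp: antipodal_free_def)
    then show ?thesis using U by (simp add: K)
  qed
  have "\<exists>U\<in>carrier ?K. card {A. covers ?K {} A \<and> A \<sqsubseteq>\<^bsub>?K\<^esub> U} = card {V. covers ?K {?p} V}"
  proof (rule upho_core_atom_count[OF L(1) iso, of "{}" UNIV])
    show "eq ?K = (=)" by (simp add: vertex_set_poset_def)
    show "least ?K {} (carrier ?K)" by (auto simp: least_def K antipodal_free_def)
    show "greatest ?K UNIV (carrier ?K)" by (auto simp: greatest_def K)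
    show "covers ?K {} {?p}" unfolding covers_vertex_set_poset_empty by blast
    show "UNIV \<sqsubseteq>\<^bsub>?K\<^esub> U" if "U \<in> carrier ?K" "\<And>V. covers ?K {?p} V \<Longrightarrow> V \<sqsubseteq>\<^bsub>?K\<^esub> U" for U
      using top[OF that] by (simp add: K)
  qed
  then obtain U where U: "U \<in> carrier ?K"
    and card: "card {A. covers ?K {} A \<and> A \<sqsubseteq>\<^bsub>?K\<^esub> U} = card {V. covers ?K {?p} V}" by blast
  have "{A. covers ?K {} A \<and> A \<sqsubseteq>\<^bsub>?K\<^esub> U} = (\<lambda>q. {q}) ` U"
    by (auto simp: covers_vertex_set_poset_empty K)
  then have 1: "card {A. covers ?K {} A \<and> A \<sqsubseteq>\<^bsub>?K\<^esub> U} = card U"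
    by (simp add: card_image)
  have "{V. covers ?K {?p} V} = (\<lambda>q. {?p, q}) ` ?Q"
    unfolding cov image_def by blast
  moreover have "inj_on (\<lambda>q. {?p, q}) ?Q"
    by (auto simp: inj_on_def doubleton_eq_iff)
  ultimately have 2: "card {V. covers ?K {?p} V} = 2 * (CARD('n) - 1)"
    by (simp add: card_image cardQ)
  have "card U = 2 * CARD('n) \<or> card U \<le> CARD('n)"
  proof (cases "U = UNIV")
    case True
    then have "U = (UNIV :: 'n set) \<times> (UNIV :: bool set)" by simp
    then show ?thesis by (simp only: card_cartesian_product) simp
  next
    case False
    then show ?thesis using U card_antipodal_free by (auto simp: K)
  qed
  \<comment> \<open>The two counts give \<open>card U\<close> = 2n - 2, which is less than 2n, and
    greater than n because n > 2.\<close>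
  then show False using card 1 2 assms(1) by linarith
qed

end
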